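(* Let $g,h:\mathbb{R}^m\to\mathbb{R}\cup\{+\infty\}$ and $\phi=g-h$ satisfy the standing assumptions described in the context, and let $x_k,u_k,y_k,d_k$ be produced by the BDCA with parameters $\alpha>0$ and $\beta\in\,]0,1[$, as described in the context. Then, for all $k\in\mathbb{N}$ (i.e. for every iteration $k$ performed by the algorithm), the following holds: (i) $\phi(y_k)\le \phi(x_k)-\rho\|d_k\|^2$; (ii) $\phi'(y_k;d_k)\le -\rho\|d_k\|^2$; (iii) there is some $\delta_k>0$ such that $$\phi(y_k+\lambda d_k)\le \phi(y_k)-\alpha\lambda^2\|d_k\|^2\quad\text{for all }\lambda\in[0,\delta_k],$$ so the backtracking in Step 4 of BDCA terminates finitely.
   Context: Problem. $\|\cdot\|$ and $\langle\cdot,\cdot\rangle$ are the Euclidean norm and inner product of $\mathbb{R}^m$. We consider $(\mathcal P)$: minimize $\phi(x):=g(x)-h(x)$ over $x\in\mathbb{R}^m$, where $g,h:\mathbb{R}^m\to\mathbb{R}\cup\{+\infty\}$ are proper convex functions, with the conventions $(+\infty)-(+\infty)=+\infty$, $(+\infty)-\lambda=+\infty$ and $\lambda-(+\infty)=-\infty$ for $\lambda\in\,]-\infty,+\infty[$. We write $\operatorname{dom} f=\{x: f(x)<+\infty\}$. Subdifferential and directional derivative. $\partial h(\bar x)=\{u\in\mathbb{R}^m: h(x)-h(\bar x)\ge\langle u,x-\bar x\rangle\ \forall x\in\mathbb{R}^m\}$ for $\bar x\in\operatorname{dom}h$, and $\partial h(\bar x)=\emptyset$ otherwise. The one-sided directional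 derivative is $\phi'(x;d)=\lim_{t\downarrow 0}\frac{\phi(x+td)-\phi(x)}{t}$. Standing assumptions. (Assumption 1) Both $g$ and $h$ are strongly convex with modulus $\rho>0$, i.e. $g-\frac{\rho}{2}\|\cdot\|^2$ and $h-\frac{\rho}{2}\|\cdot\|^2$ are convex. (Assumption 2) $\partial h(x)\ne\emptyset$ for all $x\in\operatorname{dom}h$; $g$ is continuously differentiable on an open set containing $\operatorname{dom}h$; and $\inf_{x\in\mathbb{R}^m}\phi(x)>-\infty$. BDCA (Boosted DC Algorithm). Step 1. Fix $\alpha>0$ and $0<\beta<1$. Let $x_0$ be any initial point and set $k:=0$. Step 2. Select $u_k\in\partial h(x_k)$ and solve the strongly convex problem $(\mathcal P_k)$: minimize $g(x)-\langle u_k,x\rangle$ over $x\in\mathbb{R}^m$, to obtain its unique solution $y_k$. Step 3. Set $d_k:=y_k-x_k$. If $d_k=0$, stop and return $x_k$. Otherwise go to Step 4. Step 4. Choose any $\overline\lambda_k\ge0$ and set $\lambda_k:=\overline\lambda_k$. While $\phi(y_k+\lambda_kd_k)>\phi(y_k)-\alpha\lambda_k^2\|d_k\|^2$, replace $\lambda_k:=\beta\lambda_k$. Step 5. Set $x_{k+1}:=y_k+\lambda_kd_k$, set $k:=k+1$, and go to Step 2. It is understood that Step 2 can be carried out at each iteration, i.e. $\partial h(x_k)\neq\emptyset$ and $(\mathcal P_k)$ has a (unique) solution $y_k$. *)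

theory Defs
  imports "HOL-Analysis.Analysis"
begin

definition eff_dom :: "('a \<Rightarrow> ereal) \<Rightarrow> 'a set" where
  "eff_dom f = {x. f x < \<infinity>}"

definition proper_fun :: "('a \<Rightarrow> ereal) \<Rightarrow> bool" where
  "proper_fun f \<longleftrightarrow> (\<forall>x. f x \<noteq> -\<infinity>) \<and> eff_dom f \<noteq> {}"

text \<open>The constant convex_on of the library only covers real-valued functions.
  The definition below is meant for functions that do not take the value \<open>-\<infinity>\<close>.\<close>

definition ereal_convex :: "('a::real_vector \<Rightarrow> ereal) \<Rightarrow> bool" where
  "ereal_convex f \<longleftrightarrow>
     (\<forall>x y t. 0 < t \<and> t < 1 \<longrightarrow>
        f ((1 - t) *\<^sub>R x + t *\<^sub>R y) \<le> ereal (1 - t) * f x + ereal t * f y)"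

definition strongly_convex :: "real \<Rightarrow> ('a::real_normed_vector \<Rightarrow> ereal) \<Rightarrow> bool" where
  "strongly_convex \<rho> f \<longleftrightarrow> ereal_convex (\<lambda>x. f x - ereal (\<rho> / 2 * (norm x)\<^sup>2))"

text \<open>Subtraction on \<^typ>\<open>ereal\<close> satisfies \<open>\<infinity> - \<infinity> = \<infinity>\<close>, \<open>\<infinity> - r = \<infinity>\<close> and
  \<open>r - \<infinity> = -\<infinity>\<close> for real \<open>r\<close>, which are the conventions wanted for \<open>g - h\<close>.\<close>

definition dc_fun :: "('a \<Rightarrow> ereal) \<Rightarrow> ('a \<Rightarrow> ereal) \<Rightarrow> 'a \<Rightarrow> ereal" where
  "dc_fun g h = (\<lambda>x. g x - h x)"

definition subdifferential :: "('a::real_inner \<Rightarrow> ereal) \<Rightarrow> 'a \<Rightarrow> 'a set" where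
  "subdifferential f x =
     (if x \<in> eff_dom f then {u. \<forall>z. f z - f x \<ge> ereal (u \<bullet> (z - x))} else {})"

text \<open>Being continuously differentiable on \<open>S\<close> includes being finite on \<open>S\<close>;
  \<open>G\<close> is the gradient.\<close>

definition cont_differentiable_on :: "('a::real_inner \<Rightarrow> ereal) \<Rightarrow> 'a set \<Rightarrow> bool" where
  "cont_differentiable_on f S \<longleftrightarrow>
     (\<forall>x\<in>S. \<bar>f x\<bar> \<noteq> \<infinity>) \<and>
     (\<exists>G. continuous_on S G \<and> (\<forall>x\<in>S. GDERIV (\<lambda>z. real_of_ereal (f z)) x :> G x))"

text \<open>\<open>f'(x; d)\<close> exists and equals \<open>L\<close>.\<close>

definition has_dir_deriv ::
  "('a::real_normed_vector \<Rightarrow> ereal) \<Rightarrow> 'a \<Rightarrow> 'a \<Rightarrow> ereal \<Rightarrow> bool" where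
  "has_dir_deriv f x d L \<longleftrightarrow>
     ((\<lambda>t. (f (x + t *\<^sub>R d) - f x) / ereal t) \<longlongrightarrow> L) (at_right 0)"

text \<open>Big-step semantics of the line search of BDCA: \<open>backtracking \<phi> \<alpha> \<beta> y d s s'\<close> holds iff
  the while loop entered with trial step \<open>s\<close> terminates after finitely many passes with step
  \<open>s'\<close>.\<close>

inductive backtracking ::
  "('a::real_normed_vector \<Rightarrow> ereal) \<Rightarrow> real \<Rightarrow> real \<Rightarrow> 'a \<Rightarrow> 'a \<Rightarrow> real \<Rightarrow> real \<Rightarrow> bool"
  for \<phi> :: "'a \<Rightarrow> ereal" and \<alpha> \<beta> :: real and y d :: 'a where
  stop: "\<not> \<phi> (y + s *\<^sub>R d) > \<phi> y - ereal (\<alpha> * s\<^sup>2 * (norm d)\<^sup>2)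
    \<Longrightarrow> backtracking \<phi> \<alpha> \<beta> y d s s"
| shrink: "\<phi> (y + s *\<^sub>R d) > \<phi> y - ereal (\<alpha> * s\<^sup>2 * (norm d)\<^sup>2)
    \<Longrightarrow> backtracking \<phi> \<alpha> \<beta> y d (\<beta> * s) s'
    \<Longrightarrow> backtracking \<phi> \<alpha> \<beta> y d s s'"

text \<open>The sequences record a run of BDCA in which iteration \<open>k\<close> is performed at least up to the
  computation of \<open>d k\<close>. Each iteration \<open>j < k\<close> must thus have passed the stopping test and
  completed its line search (trial step \<open>lbar j\<close>, accepted step \<open>l j\<close>), whereas nothing is
  presupposed about the line search of iteration \<open>k\<close> itself. Entries of the sequences beyond this
  point are irrelevant. That the solution \<open>y j\<close> of the subproblem is the only one is not demanded,
  as it follows from strong convexity of \<open>g\<close>.\<close>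

definition bdca_run ::
  "('a::real_inner \<Rightarrow> ereal) \<Rightarrow> ('a \<Rightarrow> ereal) \<Rightarrow> real \<Rightarrow> real \<Rightarrow>
   (nat \<Rightarrow> 'a) \<Rightarrow> (nat \<Rightarrow> 'a) \<Rightarrow> (nat \<Rightarrow> 'a) \<Rightarrow> (nat \<Rightarrow> 'a) \<Rightarrow>
   (nat \<Rightarrow> real) \<Rightarrow> (nat \<Rightarrow> real) \<Rightarrow> nat \<Rightarrow> bool" where
  "bdca_run g h \<alpha> \<beta> x u y d lbar l k \<longleftrightarrow>
     (\<forall>j\<le>k. u j \<in> subdifferential h (x j) \<and>
        is_arg_min (\<lambda>z. g z - ereal (u j \<bullet> z)) (\<lambda>z. True) (y j) \<and>
        d j = y j - x j) \<and>
     (\<forall>j<k. d j \<noteq> 0 \<and> lbar j \<ge> 0 \<and>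
        backtracking (dc_fun g h) \<alpha> \<beta> (y j) (d j) (lbar j) (l j) \<and>
        x (Suc j) = y j + l j *\<^sub>R d j)"

end

theory Submission
  imports Defs
begin

text \<open>Since \<open>\<phi>\<close> is bounded below, \<open>dom g \<subseteq> dom h\<close>; as \<open>g\<close> is finite on an open set containing
  \<open>dom h\<close>, both domains coincide with that open set, so \<open>y\<^sub>k\<close> is an interior point of them.
  Optimality of \<open>y\<^sub>k\<close> gives \<open>u\<^sub>k \<in> \<partial>g(y\<^sub>k)\<close>, hence \<open>u\<^sub>k = \<nabla>g(y\<^sub>k)\<close>. Adding the strong subgradient
  inequalities of \<open>g\<close> at \<open>y\<^sub>k\<close> and of \<open>h\<close> at \<open>x\<^sub>k\<close> yields (i). For \<open>v \<in> \<partial>h(y\<^sub>k)\<close>,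
  \<open>\<phi>'(y\<^sub>k; d\<^sub>k) = \<langle>u\<^sub>k, d\<^sub>k\<rangle> - h'(y\<^sub>k; d\<^sub>k) \<le> \<langle>u\<^sub>k - v, d\<^sub>k\<rangle>\<close>, which is at most \<open>-\<rho>\<parallel>d\<^sub>k\<parallel>\<^sup>2\<close> by strong
  monotonicity of \<open>\<partial>h\<close>; this is (ii), and (iii) follows because the required decrease is only
  quadratic in the step.\<close>

section \<open>Quadratic growth from strong convexity\<close>

lemma norm_sq_convex_combination:
  fixes x z :: "'a::real_inner"
  shows "(1 - t) * (norm x)\<^sup>2 + t * (norm z)\<^sup>2 - (norm ((1 - t) *\<^sub>R x + t *\<^sub>R z))\<^sup>2
    = t * (1 - t) * (norm (z - x))\<^sup>2"
  unfolding power2_norm_eq_inner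
  by (simp add: inner_commute algebra_simps power2_eq_square)

text \<open>Evaluate the plain subgradient inequality and the strong convexity inequality at the
  same point between \<open>x\<close> and \<open>z\<close>. Dividing by \<open>t\<close> leaves the
  quadratic term with factor \<open>1 - t\<close>, and letting \<open>t\<close> tend to
  \<open>0\<close> recovers it in full.\<close>

lemma strongly_convex_subgradient_ineq:
  fixes f :: "'a::real_inner \<Rightarrow> ereal"
  assumes sc: "strongly_convex \<rho> f" and u: "u \<in> subdifferential f x"
    and fx: "f x = ereal a" and fz: "f z = ereal b"
  shows "a + u \<bullet> (z - x) + \<rho> / 2 * (norm (z - x))\<^sup>2 \<le> b"
proof -
  define N where "N = \<rho> / 2 * (norm (z - x))\<^sup>2"
  have *: "a + u \<bullet> (z - x) + (1 - t) * N \<le> b" if t: "0 < t" "t < 1" for t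
  proof -
    define w where "w = (1 - t) *\<^sub>R x + t *\<^sub>R z"
    have wx: "w - x = t *\<^sub>R (z - x)" by (simp add: w_def algebra_simps)
    have le: "f w - ereal (\<rho> / 2 * (norm w)\<^sup>2)
      \<le> ereal ((1 - t) * (a - \<rho> / 2 * (norm x)\<^sup>2) + t * (b - \<rho> / 2 * (norm z)\<^sup>2))"
      using sc[unfolded strongly_convex_def ereal_convex_def, rule_format, of t x z] t
      by (simp add: w_def fx fz)
    have ge: "ereal (t * (u \<bullet> (z - x))) \<le> f w - ereal a"
      using u fx wx unfolding subdifferential_def
      by (auto split: if_splits dest!: spec[of _ w])
    \<comment> \<open>The bound \<open>le\<close> excludes the value \<open>\<infinity>\<close>, and
      \<open>ge\<close> excludes \<open>-\<infinity>\<close>.\<close>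
    obtain c where c: "f w = ereal c"
      using le ge by (cases "f w") auto
    have "c \<le> (1 - t) * a + t * b
        - \<rho> / 2 * ((1 - t) * (norm x)\<^sup>2 + t * (norm z)\<^sup>2 - (norm w)\<^sup>2)"
      using le c by (simp add: algebra_simps diff_divide_distrib)
    also have "\<dots> = (1 - t) * a + t * b - t * (1 - t) * N"
      unfolding w_def norm_sq_convex_combination N_def by simp
    finally have "t * (a + u \<bullet> (z - x) + (1 - t) * N) \<le> t * b"
      using ge c by (simp add: algebra_simps)
    with t show ?thesis by simp
  qed
  have "((\<lambda>t. a + u \<bullet> (z - x) + (1 - t) * N) \<longlongrightarrow> a + u \<bullet> (z - x) + (1 - 0) * N) (at_right 0)"
    by (intro tendsto_intros)
  moreover have "\<forall>\<^sub>F t in at_right 0. a + u \<bullet> (z - x) + (1 - t) * N \<le> b"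
    unfolding eventually_at_right_field using * by (intro exI[of _ 1]) auto
  ultimately show ?thesis
    using tendsto_upperbound[of _ _ "at_right (0::real)" b] N_def by fastforce
qed

section \<open>One-sided limits of difference quotients of convex functions\<close>

lemma mono_on_tendsto_at_right:
  fixes q :: "real \<Rightarrow> real"
  assumes "a < b" and mono: "mono_on {a<..b} q" and lb: "\<And>t. t \<in> {a<..b} \<Longrightarrow> m \<le> q t"
  shows "(q \<longlongrightarrow> Inf (q ` {a<..b})) (at_right a)"
proof -
  have bdd: "bdd_below (q ` {a<..b})" using lb by (intro bdd_belowI[of _ m]) auto
  have ne: "q ` {a<..b} \<noteq> {}" using \<open>a < b\<close> by auto
  show ?thesis
  proof (rule order_tendstoI)
    fix c assume "c < Inf (q ` {a<..b})"
    then have "c < q t" if "t \<in> {a<..b}" for t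
      using cInf_lower[OF imageI[OF that] bdd] by simp
    then show "\<forall>\<^sub>F t in at_right a. c < q t"
      unfolding eventually_at_right_field using \<open>a < b\<close> by (intro exI[of _ b]) auto
  next
    fix c assume "Inf (q ` {a<..b}) < c"
    then obtain t where t: "t \<in> {a<..b}" "q t < c"
      using cInf_less_iff[OF ne bdd] by auto
    have "q s < c" if "a < s" "s < t" for s
      using mono_onD[OF mono, of s t] that t by auto
    then show "\<forall>\<^sub>F t in at_right a. q t < c"
      unfolding eventually_at_right_field using t by (intro exI[of _ t]) auto
  qed
qed

text \<open>Convexity makes the difference quotient nondecreasing in \<open>t\<close>, and the
  subgradient \<open>v\<close> bounds it below by \<open>v \<bullet> d\<close>; hence it converges
  to its infimum, which obeys the same bound.\<close>

lemma ereal_convex_directional_limit: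
  fixes f :: "'a::real_inner \<Rightarrow> ereal"
  assumes conv: "ereal_convex f" and "e > 0"
    and fin: "\<And>t. t \<in> {0..e} \<Longrightarrow> f (y + t *\<^sub>R d) = ereal (F t)"
    and v: "v \<in> subdifferential f y"
  shows "\<exists>L \<ge> v \<bullet> d. ((\<lambda>t. (F t - F 0) / t) \<longlongrightarrow> L) (at_right 0)"
proof -
  define q where "q = (\<lambda>t. (F t - F 0) / t)"
  have f0: "f y = ereal (F 0)" using fin[of 0] \<open>e > 0\<close> by simp
  have lb: "v \<bullet> d \<le> q t" if t: "t \<in> {0<..e}" for t
  proof -
    have "ereal (v \<bullet> (t *\<^sub>R d)) \<le> f (y + t *\<^sub>R d) - f y"
      using v unfolding subdifferential_def
      by (auto split: if_splits dest!: spec[of _ "y + t *\<^sub>R d"])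
    then show ?thesis using fin[of t] t f0 by (simp add: q_def field_simps)
  qed
  have mono: "mono_on {0<..e} q"
  proof (rule mono_onI)
    fix s t assume st: "s \<in> {0<..e}" "t \<in> {0<..e}" "s \<le> t"
    show "q s \<le> q t"
    proof (cases "s = t")
      case False
      \<comment> \<open>This weight places \<open>y + s *\<^sub>R d\<close> between \<open>y\<close>
        and \<open>y + t *\<^sub>R d\<close>; the case \<open>s = t\<close> is split off because
        convexity is stated for weights strictly below \<open>1\<close>.\<close>
      define \<tau> where "\<tau> = s / t"
      have \<tau>: "0 < \<tau>" "\<tau> < 1" using st False by (auto simp: \<tau>_def)
      have "(1 - \<tau>) *\<^sub>R y + \<tau> *\<^sub>R (y + t *\<^sub>R d) = y + s *\<^sub>R d"
        using st by (simp add: \<tau>_def algebra_simps)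
      moreover have "f ((1 - \<tau>) *\<^sub>R y + \<tau> *\<^sub>R (y + t *\<^sub>R d))
          \<le> ereal (1 - \<tau>) * f y + ereal \<tau> * f (y + t *\<^sub>R d)"
        using conv \<tau> unfolding ereal_convex_def by blast
      ultimately have "F s \<le> (1 - \<tau>) * F 0 + \<tau> * F t"
        using st fin[of s] fin[of t] f0 by simp
      then have "F s - F 0 \<le> s * ((F t - F 0) / t)"
        by (simp add: \<tau>_def algebra_simps diff_divide_distrib)
      then show ?thesis using st by (simp add: q_def pos_divide_le_eq mult.commute)
    qed simp
  qed
  have "v \<bullet> d \<le> Inf (q ` {0<..e})"
    using lb \<open>e > 0\<close> by (intro cInf_greatest) auto
  then show ?thesis
    using mono_on_tendsto_at_right[OF \<open>e > 0\<close> mono lb] unfolding q_def by blast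
qed

section \<open>Optimality conditions for the smooth component\<close>

lemma is_arg_min_subdifferential:
  fixes f :: "'a::real_inner \<Rightarrow> ereal"
  assumes "proper_fun f" and min: "is_arg_min (\<lambda>z. f z - ereal (u \<bullet> z)) (\<lambda>z. True) y"
  shows "u \<in> subdifferential f y"
proof -
  have le: "f y - ereal (u \<bullet> y) \<le> f z - ereal (u \<bullet> z)" for z
    using min by (auto simp: is_arg_min_def not_less)
  obtain z0 where "f z0 < \<infinity>" and nm: "\<And>z. f z \<noteq> -\<infinity>"
    using \<open>proper_fun f\<close> by (auto simp: proper_fun_def eff_dom_def)
  \<comment> \<open>Comparison with a point of finite value, supplied by properness, keeps the
    minimizer in the domain.\<close>
  then have "f y < \<infinity>" using le[of z0] by (cases "f y"; cases "f z0") auto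
  moreover have "ereal (u \<bullet> (z - y)) \<le> f z - f y" for z
    using le[of z] nm[of z] nm[of y] \<open>f y < \<infinity>\<close>
    by (cases "f y"; cases "f z") (auto simp: inner_diff_right)
  ultimately show ?thesis by (auto simp: subdifferential_def eff_dom_def)
qed

lemma open_contains_line_segment:
  fixes y d :: "'a::real_normed_vector"
  assumes "open S" "y \<in> S"
  obtains e where "e > 0" "\<And>t. \<bar>t\<bar> \<le> e \<Longrightarrow> y + t *\<^sub>R d \<in> S"
proof -
  obtain r where r: "r > 0" "ball y r \<subseteq> S" using assms openE by blast
  show ?thesis
  \<comment> \<open>Adding \<open>1\<close> covers \<open>d = 0\<close> and makes the displacement
    strictly shorter than \<open>r\<close>.\<close>
  proof (rule that[of "r / (norm d + 1)"])
    show "r / (norm d + 1) > 0" using r by (simp add: add_nonneg_pos)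
    fix t :: real assume "\<bar>t\<bar> \<le> r / (norm d + 1)"
    then have "\<bar>t\<bar> * (norm d + 1) \<le> r" by (simp add: pos_le_divide_eq add_nonneg_pos)
    then have "norm (t *\<^sub>R d) < r"
      using r by (cases "t = 0") (auto simp: algebra_simps)
    then show "y + t *\<^sub>R d \<in> S" using r by (auto simp: dist_norm)
  qed
qed

text \<open>By the subgradient inequality, \<open>F t - t * (u \<bullet> d)\<close> has a local
  minimum at \<open>0\<close>, so its derivative \<open>G \<bullet> d - u \<bullet> d\<close>
  vanishes. Working along the single direction \<open>d\<close> avoids identifying \<open>u\<close>
  with \<open>G\<close>.\<close>

lemma subdifferential_directional_derivative:
  fixes f :: "'a::real_inner \<Rightarrow> ereal"
  assumes "open S" "y \<in> S" and fin: "\<And>z. z \<in> S \<Longrightarrow> \<bar>f z\<bar> \<noteq> \<infinity>"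
    and u: "u \<in> subdifferential f y"
    and G: "GDERIV (\<lambda>z. real_of_ereal (f z)) y :> G"
  shows "((\<lambda>t. real_of_ereal (f (y + t *\<^sub>R d))) has_real_derivative u \<bullet> d) (at 0)"
proof -
  define F where "F = (\<lambda>t. real_of_ereal (f (y + t *\<^sub>R d)))"
  obtain e where e: "e > 0" "\<And>t. \<bar>t\<bar> \<le> e \<Longrightarrow> y + t *\<^sub>R d \<in> S"
    using open_contains_line_segment[OF assms(1,2), of d] by blast
  have fin': "f (y + t *\<^sub>R d) = ereal (F t)" if "\<bar>t\<bar> \<le> e" for t
    using fin[OF e(2)[OF that]] by (simp add: F_def ereal_real)
  have Gd: "((\<lambda>z. real_of_ereal (f z)) has_derivative (\<lambda>h. h \<bullet> G)) (at (y + 0 *\<^sub>R d))"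
    using G by (simp add: gderiv_def inner_commute)
  have "((\<lambda>t. y + t *\<^sub>R d) has_derivative (\<lambda>t. t *\<^sub>R d)) (at 0)"
    by (auto intro!: derivative_eq_intros)
  from has_derivative_compose[OF this Gd]
  have F': "(F has_real_derivative G \<bullet> d) (at 0)"
    unfolding F_def has_field_derivative_def
    by (rule has_derivative_eq_rhs) (simp add: fun_eq_iff inner_commute)
  have "((\<lambda>t. F t - t * (u \<bullet> d)) has_real_derivative G \<bullet> d - u \<bullet> d) (at 0)"
    using F' by (auto intro!: derivative_eq_intros)
  moreover have "F 0 - 0 * (u \<bullet> d) \<le> F t - t * (u \<bullet> d)" if "\<bar>0 - t\<bar> < e" for t
  proof -
    have "ereal (u \<bullet> (t *\<^sub>R d)) \<le> f (y + t *\<^sub>R d) - f y"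
      using u unfolding subdifferential_def
      by (auto split: if_splits dest!: spec[of _ "y + t *\<^sub>R d"])
    then show ?thesis using fin'[of t] fin'[of 0] that e(1) by simp
  qed
  ultimately have "G \<bullet> d - u \<bullet> d = 0"
    using DERIV_local_min[OF _ \<open>e > 0\<close>] by blast
  then show ?thesis using F' unfolding F_def by simp
qed

section \<open>Termination of the line search\<close>

lemma backtracking_terminates:
  assumes "0 < \<beta>" "\<beta> < 1" "\<delta> > 0" "s0 \<ge> 0"
    and dec: "\<And>s. s \<in> {0..\<delta>} \<Longrightarrow>
      \<phi> (y + s *\<^sub>R d) \<le> \<phi> y - ereal (\<alpha> * s\<^sup>2 * (norm d)\<^sup>2)"
  shows "\<exists>s. backtracking \<phi> \<alpha> \<beta> y d s0 s"
proof -
  \<comment> \<open>Here \<open>n\<close> only bounds the number of shrinkings: the loop may already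
    accept a step larger than \<open>\<delta>\<close>.\<close>
  have steps: "\<exists>s'. backtracking \<phi> \<alpha> \<beta> y d s s'" if "s \<ge> 0" "\<beta> ^ n * s \<le> \<delta>" for n s
    using that
  proof (induction n arbitrary: s)
    case 0
    then show ?case using dec[of s] by (intro exI[of _ s] backtracking.stop) (auto simp: not_less)
  next
    case (Suc n)
    have "\<exists>s'. backtracking \<phi> \<alpha> \<beta> y d (\<beta> * s) s'"
      using Suc.IH[of "\<beta> * s"] Suc.prems \<open>0 < \<beta>\<close> by (simp add: mult_ac)
    then show ?case by (meson backtracking.intros)
  qed
  obtain n where "\<beta> ^ n < \<delta> / (s0 + 1)"
    using real_arch_pow_inv[of "\<delta> / (s0 + 1)" \<beta>] assms by auto
  then have "\<beta> ^ n * (s0 + 1) < \<delta>" using \<open>s0 \<ge> 0\<close> by (simp add: pos_less_divide_eq)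
  moreover have "\<beta> ^ n * s0 \<le> \<beta> ^ n * (s0 + 1)" using \<open>0 < \<beta>\<close> by simp
  ultimately show ?thesis using steps[of s0 n] \<open>s0 \<ge> 0\<close> by simp
qed

theorem proposition3p1:
  fixes g h :: "real ^ 'm \<Rightarrow> ereal"
    and \<rho> \<alpha> \<beta> :: real
    and x u y d :: "nat \<Rightarrow> real ^ 'm"
    and lbar l :: "nat \<Rightarrow> real"
    and k :: nat
  assumes "proper_fun g" "ereal_convex g"
    and "proper_fun h" "ereal_convex h"
    and "\<rho> > 0" "strongly_convex \<rho> g" "strongly_convex \<rho> h"
    and "\<forall>z\<in>eff_dom h. subdifferential h z \<noteq> {}"
    and "\<exists>S. open S \<and> eff_dom h \<subseteq> S \<and> cont_differentiable_on g S"
    and "(INF z. dc_fun g h z) > -\<infinity>"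
    and "\<alpha> > 0" "0 < \<beta>" "\<beta> < 1"
    and "bdca_run g h \<alpha> \<beta> x u y d lbar l k"
  shows "dc_fun g h (y k) \<le> dc_fun g h (x k) - ereal (\<rho> * (norm (d k))\<^sup>2) \<and>
    (\<exists>L::real. has_dir_deriv (dc_fun g h) (y k) (d k) (ereal L) \<and> L \<le> - \<rho> * (norm (d k))\<^sup>2) \<and>
    (\<exists>\<delta>>0. \<forall>s\<in>{0..\<delta>}.
       dc_fun g h (y k + s *\<^sub>R d k) \<le> dc_fun g h (y k) - ereal (\<alpha> * s\<^sup>2 * (norm (d k))\<^sup>2)) \<and>
    (\<forall>s0\<ge>0. \<exists>s. backtracking (dc_fun g h) \<alpha> \<beta> (y k) (d k) s0 s)"
proof -
  define X U Y D where "X = x k" and "U = u k" and "Y = y k" and "D = d k"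
  have U: "U \<in> subdifferential h X" and D: "D = Y - X"
    and Ymin: "is_arg_min (\<lambda>z. g z - ereal (U \<bullet> z)) (\<lambda>z. True) Y"
    using \<open>bdca_run g h \<alpha> \<beta> x u y d lbar l k\<close>
    unfolding bdca_run_def X_def U_def Y_def D_def by blast+
  have Ug: "U \<in> subdifferential g Y"
    using is_arg_min_subdifferential[OF \<open>proper_fun g\<close> Ymin] .
  obtain S where S: "open S" "eff_dom h \<subseteq> S" and diff: "cont_differentiable_on g S"
    using assms(9) by (elim exE conjE)
  obtain G where gfin: "\<And>z. z \<in> S \<Longrightarrow> \<bar>g z\<bar> \<noteq> \<infinity>"
    and G: "\<And>z. z \<in> S \<Longrightarrow> GDERIV (\<lambda>z. real_of_ereal (g z)) z :> G z"
    using diff unfolding cont_differentiable_on_def by (elim exE conjE) auto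
  have hfin: "\<bar>h z\<bar> \<noteq> \<infinity>" if "g z < \<infinity>" for z
  proof -
    \<comment> \<open>With \<open>g z\<close> finite, \<open>h z = \<infinity>\<close> would give
      the objective the value \<open>-\<infinity>\<close>.\<close>
    have "dc_fun g h z > -\<infinity>" using assms(10) by (rule less_INF_D) simp
    moreover have "h z \<noteq> -\<infinity>" "g z \<noteq> -\<infinity>"
      using assms(1,3) by (auto simp: proper_fun_def)
    ultimately show ?thesis using that
      by (cases "g z"; cases "h z") (auto simp: dc_fun_def)
  qed
  have Shfin: "\<bar>h z\<bar> \<noteq> \<infinity>" if "z \<in> S" for z
    using gfin[OF that] by (intro hfin) auto
  have "X \<in> eff_dom h" using U by (auto simp: subdifferential_def split: if_splits)
  then have XS: "X \<in> S" using S by auto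
  have "g Y < \<infinity>" using Ug by (auto simp: subdifferential_def eff_dom_def split: if_splits)
  then have Yh: "Y \<in> eff_dom h" using hfin[of Y] by (auto simp: eff_dom_def)
  then have YS: "Y \<in> S" using S by auto
  define gr hr where "gr = (\<lambda>z. real_of_ereal (g z))" and "hr = (\<lambda>z. real_of_ereal (h z))"
  have g: "g z = ereal (gr z)" and h: "h z = ereal (hr z)" if "z \<in> S" for z
    using gfin[OF that] Shfin[OF that] by (simp_all add: gr_def hr_def ereal_real)
  obtain v where v: "v \<in> subdifferential h Y" using assms(8) Yh by auto

  \<comment> \<open>Descent from \<open>X\<close> to \<open>Y\<close> and strong
    monotonicity\<close>
  have ineq_g: "gr Y + U \<bullet> (X - Y) + \<rho> / 2 * (norm (X - Y))\<^sup>2 \<le> gr X"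
    using strongly_convex_subgradient_ineq[OF assms(6) Ug g[OF YS] g[OF XS]] .
  have ineq_h: "hr X + U \<bullet> (Y - X) + \<rho> / 2 * (norm (Y - X))\<^sup>2 \<le> hr Y"
    using strongly_convex_subgradient_ineq[OF assms(7) U h[OF XS] h[OF YS]] .
  have ineq_v: "hr Y + v \<bullet> (X - Y) + \<rho> / 2 * (norm (X - Y))\<^sup>2 \<le> hr X"
    using strongly_convex_subgradient_ineq[OF assms(7) v h[OF YS] h[OF XS]] .
  have i: "dc_fun g h Y \<le> dc_fun g h X - ereal (\<rho> * (norm D)\<^sup>2)"
    using ineq_g ineq_h
    by (simp add: dc_fun_def g h XS YS D norm_minus_commute inner_diff_right)
  \<comment> \<open>The values of \<open>hr\<close> cancel in the sum of \<open>ineq_h\<close> and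
    \<open>ineq_v\<close>, and the two halves of the quadratic term add up.\<close>
  have strong_mono: "U \<bullet> D - v \<bullet> D \<le> - \<rho> * (norm D)\<^sup>2"
    using ineq_v ineq_h by (simp add: D norm_minus_commute inner_diff_right)

  \<comment> \<open>The directional derivative of the objective at \<open>Y\<close>\<close>
  obtain e where e: "e > 0" "\<And>t. \<bar>t\<bar> \<le> e \<Longrightarrow> Y + t *\<^sub>R D \<in> S"
    using open_contains_line_segment[OF S(1) YS, of D] by blast
  define p where "p = (\<lambda>t. gr (Y + t *\<^sub>R D) - hr (Y + t *\<^sub>R D))"
  have p: "dc_fun g h (Y + t *\<^sub>R D) = ereal (p t)" if "0 \<le> t" "t \<le> e" for t
    using e(2)[of t] that by (simp add: dc_fun_def g h p_def)
  have p0: "dc_fun g h Y = ereal (p 0)" using p[of 0] e(1) by simp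
  have "((\<lambda>t. gr (Y + t *\<^sub>R D)) has_real_derivative U \<bullet> D) (at 0)"
    using subdifferential_directional_derivative[OF S(1) YS gfin Ug G[OF YS]]
    unfolding gr_def .
  then have g_lim: "((\<lambda>t. (gr (Y + t *\<^sub>R D) - gr (Y + 0 *\<^sub>R D)) / t) \<longlongrightarrow> U \<bullet> D) (at_right 0)"
    by (auto simp: DERIV_def intro: tendsto_mono[OF at_le])
  obtain M where M: "v \<bullet> D \<le> M"
    "((\<lambda>t. (hr (Y + t *\<^sub>R D) - hr (Y + 0 *\<^sub>R D)) / t) \<longlongrightarrow> M) (at_right 0)"
    using ereal_convex_directional_limit[OF assms(4) e(1) _ v,
        where F = "\<lambda>t. hr (Y + t *\<^sub>R D)" and d = D] h e(2) by auto
  define L where "L = U \<bullet> D - M"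
  have L: "((\<lambda>t. (p t - p 0) / t) \<longlongrightarrow> L) (at_right 0)"
    using tendsto_diff[OF g_lim M(2)]
    by (simp add: L_def p_def diff_divide_distrib add_divide_distrib algebra_simps)
  have L_le: "L \<le> - \<rho> * (norm D)\<^sup>2" using strong_mono M(1) by (simp add: L_def)
  have "\<forall>\<^sub>F t in at_right 0.
      ereal ((p t - p 0) / t) = (dc_fun g h (Y + t *\<^sub>R D) - dc_fun g h Y) / ereal t"
    unfolding eventually_at_right_field using e(1) p p0 by (intro exI[of _ e]) auto
  from Lim_transform_eventually[OF tendsto_ereal[OF L] this]
  have ii: "has_dir_deriv (dc_fun g h) Y D (ereal L)"
    by (simp add: has_dir_deriv_def)

  \<comment> \<open>Sufficient decrease for small steps\<close>
  have iii: "\<exists>\<delta>>0. \<forall>s\<in>{0..\<delta>}.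
       dc_fun g h (Y + s *\<^sub>R D) \<le> dc_fun g h Y - ereal (\<alpha> * s\<^sup>2 * (norm D)\<^sup>2)"
  proof (cases "D = 0")
    case True
    then show ?thesis by (intro exI[of _ 1]) auto
  next
    case False
    then have "0 < \<rho> * (norm D)\<^sup>2" using \<open>\<rho> > 0\<close> by simp
    \<comment> \<open>Halving the slope creates the strict gap that passes from the limit to all
      small difference quotients.\<close>
    with L_le have "L < - (\<rho> / 2) * (norm D)\<^sup>2" by (simp del: zero_less_mult_iff)
    then have "\<forall>\<^sub>F t in at_right 0. (p t - p 0) / t < - (\<rho> / 2) * (norm D)\<^sup>2"
      using L order_tendstoD(2) by blast
    then obtain b where b: "b > 0"
      "\<And>t. 0 < t \<Longrightarrow> t < b \<Longrightarrow> (p t - p 0) / t < - (\<rho> / 2) * (norm D)\<^sup>2"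
      unfolding eventually_at_right_field by auto
    \<comment> \<open>The three bounds serve in turn to keep \<open>s\<close> strictly below
      \<open>b\<close>, to keep the segment inside \<open>S\<close>, and to ensure
      \<open>\<alpha> * s \<le> \<rho> / 2\<close>, so that the linear decrease dominates the
      quadratic requirement.\<close>
    define \<delta> where "\<delta> = min (b / 2) (min e (\<rho> / (2 * \<alpha>)))"
    have "\<delta> > 0" using b e \<open>\<alpha> > 0\<close> \<open>\<rho> > 0\<close> by (simp add: \<delta>_def)
    moreover have "dc_fun g h (Y + s *\<^sub>R D) \<le> dc_fun g h Y - ereal (\<alpha> * s\<^sup>2 * (norm D)\<^sup>2)"
      if s: "s \<in> {0..\<delta>}" for s
    proof (cases "s = 0")
      case True
      then show ?thesis by (simp add: p0)
    next
      case False
      then have s': "0 < s" "s < b" "s \<le> e" "s \<le> \<rho> / (2 * \<alpha>)"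
        using s b(1) by (auto simp: \<delta>_def)
      have "\<alpha> * s \<le> \<rho> / 2" using s'(4) \<open>\<alpha> > 0\<close> by (simp add: field_simps)
      then have "\<alpha> * s * (s * (norm D)\<^sup>2) \<le> \<rho> / 2 * (s * (norm D)\<^sup>2)"
        using s'(1) by (intro mult_right_mono) auto
      moreover have "p s - p 0 < - (\<rho> / 2) * (norm D)\<^sup>2 * s"
        using b(2)[OF s'(1,2)] s'(1) by (simp only: pos_divide_less_eq)
      ultimately have "p s \<le> p 0 - \<alpha> * s\<^sup>2 * (norm D)\<^sup>2"
        by (simp add: power2_eq_square algebra_simps)
      then show ?thesis using p[of s] s' p0 by simp
    qed
    ultimately show ?thesis by blast
  qed
  then obtain \<delta> where \<delta>: "\<delta> > 0" "\<And>s. s \<in> {0..\<delta>} \<Longrightarrow>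
       dc_fun g h (Y + s *\<^sub>R D) \<le> dc_fun g h Y - ereal (\<alpha> * s\<^sup>2 * (norm D)\<^sup>2)" by blast
  have iv: "\<exists>s. backtracking (dc_fun g h) \<alpha> \<beta> Y D s0 s" if "s0 \<ge> 0" for s0
    using backtracking_terminates[OF assms(12,13) \<delta>(1) that \<delta>(2)] by blast
  show ?thesis
    using i ii L_le iii iv unfolding X_def Y_def D_def by blast
qed

end
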